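(* Let $f\in C^2(\mathbb R^m)$ satisfy: (i) there is $L_f<\infty$ with $\|\nabla f(x)-\nabla f(\bar x)\|\le L_f\|x-\bar x\|$ for all $x,\bar x\in\mathbb R^m$; (ii) there are $m_f>0$, $c\ge0$, $R\ge0$ with $\langle\nabla f(x),x\rangle\ge m_f\|x\|^2-c$ for all $\|x\|\ge R$. Let $A(x):=\mathrm{Diag}(\nabla f(x))\,H_f(x)$, where $H_f(x)$ is the Hessian of $f$ at $x$, and let $\mathcal D_A^\dagger:=\{x\in\mathbb R^m:\det A(x)=0\}$. Then $\mathcal D_A^\dagger\ne\mathbb R^m$.
   Context: $\mathrm{Diag}(v)$ is the diagonal matrix with diagonal entries $v_1,\dots,v_m$. *)

theory Defs
  imports "HOL-Analysis.Analysis"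
begin

(* At a point of differentiability the D below exists and is unique;
   elsewhere the value is unspecified. *)
definition grad :: "(real ^ 'm \<Rightarrow> real) \<Rightarrow> real ^ 'm \<Rightarrow> real ^ 'm" where
  "grad f x = (THE D. GDERIV f x :> D)"

(* The Jacobian matrix of the gradient: the entry in row i and column j is the
   partial derivative of (grad f) $ i in direction j. *)
definition hessian :: "(real ^ 'm \<Rightarrow> real) \<Rightarrow> real ^ 'm \<Rightarrow> real ^ 'm ^ 'm" where
  "hessian f x = matrix (frechet_derivative (grad f) (at x))"

definition C2 :: "(real ^ 'm \<Rightarrow> real) \<Rightarrow> bool" where
  "C2 f \<longleftrightarrow> f differentiable_on UNIV \<and> grad f differentiable_on UNIV \<and>
     continuous_on UNIV (hessian f)"

definition Diag :: "real ^ 'm \<Rightarrow> real ^ 'm ^ 'm" where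
  "Diag v = (\<chi> i j. if i = j then v $ i else 0)"

definition A_mat :: "(real ^ 'm \<Rightarrow> real) \<Rightarrow> real ^ 'm \<Rightarrow> real ^ 'm ^ 'm" where
  "A_mat f x = Diag (grad f x) ** hessian f x"

definition D_dagger :: "(real ^ 'm \<Rightarrow> real ^ 'm ^ 'm) \<Rightarrow> (real ^ 'm) set" where
  "D_dagger A = {x. det (A x) = 0}"

end

theory Submission
  imports Defs
begin

text \<open>Coercivity and Brouwer's fixed point theorem make the gradient surjective. If
  \<open>det A\<close> vanished everywhere, every value of the gradient would be either a critical value or
  a point with a vanishing coordinate, and these form a null set by Sard's theorem.\<close>

text \<open>The library's \<open>baby_Sard\<close> demands well-ordered index types; indexing coordinates by an
  enumerated basis removes this restriction.\<close>

typedef (overloaded) 'a basis_index = "Basis :: 'a::euclidean_space set"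
  using nonempty_Basis by blast

lemma bij_betw_Rep_basis_index: "bij_betw Rep_basis_index UNIV Basis"
  using type_definition.Rep_range[OF type_definition_basis_index] Rep_basis_index_inject
  by (auto simp: bij_betw_def inj_on_def)

instance basis_index :: (euclidean_space) finite
  by standard (use bij_betw_finite[OF bij_betw_Rep_basis_index] in auto)

lemma CARD_basis_index: "CARD('a::euclidean_space basis_index) = DIM('a)"
  by (rule bij_betw_same_card[OF bij_betw_Rep_basis_index])

text \<open>\<open>to_nat_on\<close> is injective on the finite set \<open>Basis\<close>, so pulling
  back the order of the naturals along this numbering gives a well-order on the indices.\<close>

definition basis_position :: "'a::euclidean_space basis_index \<Rightarrow> nat" where
  "basis_position i = to_nat_on Basis (Rep_basis_index i)"

lemma basis_position_eq_iff: "basis_position i = basis_position j \<longleftrightarrow> i = j"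
  by (simp add: basis_position_def countable_finite Rep_basis_index Rep_basis_index_inject)

instantiation basis_index :: (euclidean_space) wellorder
begin

definition less_eq_basis_index :: "'a basis_index \<Rightarrow> 'a basis_index \<Rightarrow> bool" where
  "i \<le> j \<longleftrightarrow> basis_position i \<le> basis_position j"

definition less_basis_index :: "'a basis_index \<Rightarrow> 'a basis_index \<Rightarrow> bool" where
  "i < j \<longleftrightarrow> basis_position i < basis_position j"

instance
proof
  show "P i" if step: "\<And>i. (\<And>j. j < i \<Longrightarrow> P j) \<Longrightarrow> P i" for P and i :: "'a basis_index"
    by (induction i rule: measure_induct_rule[of basis_position])
      (rule step, simp add: less_basis_index_def)
qed (auto simp: less_eq_basis_index_def less_basis_index_def basis_position_eq_iff
    dest: order_antisym)

end

text \<open>Sard's theorem in equal dimensions, with rank deficiency expressed as non-surjectivity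
  so that no coordinates are needed. Conjugating by a linear isomorphism onto
  \<open>real ^ 'a basis_index\<close> reduces it to \<open>baby_Sard\<close>.\<close>

lemma negligible_critical_values:
  fixes f :: "'a::euclidean_space \<Rightarrow> 'a"
  assumes der: "\<And>x. x \<in> S \<Longrightarrow> (f has_derivative f' x) (at x within S)"
    and crit: "\<And>x. x \<in> S \<Longrightarrow> \<not> surj (f' x)"
  shows "negligible (f ` S)"
proof -
  obtain \<phi> :: "'a \<Rightarrow> real ^ 'a basis_index" and \<psi> where
    lin: "linear \<phi>" "linear \<psi>" and inv: "\<And>x. \<psi> (\<phi> x) = x" "\<And>y. \<phi> (\<psi> y) = y"
    by (rule isomorphisms_UNIV_UNIV[where 'M='a and 'N="real ^ 'a basis_index"])
      (simp add: CARD_basis_index, blast)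
  define F where "F = \<phi> \<circ> f \<circ> \<psi>"
  define F' where "F' y = \<phi> \<circ> f' (\<psi> y) \<circ> \<psi>" for y
  have "negligible (F ` \<phi> ` S)"
  proof (rule baby_Sard)
    fix y assume "y \<in> \<phi> ` S"
    then have y: "\<psi> y \<in> S" and img: "\<psi> ` \<phi> ` S = S"
      by (auto simp: inv image_image)
    have "(f \<circ> \<psi> has_derivative f' (\<psi> y) \<circ> \<psi>) (at y within \<phi> ` S)"
      by (rule diff_chain_within) (use der[OF y] img lin in \<open>auto intro: linear_imp_has_derivative\<close>)
    then have "(\<phi> \<circ> (f \<circ> \<psi>) has_derivative \<phi> \<circ> (f' (\<psi> y) \<circ> \<psi>)) (at y within \<phi> ` S)"
      by (rule diff_chain_within) (use lin in \<open>auto intro: linear_imp_has_derivative\<close>)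
    then show der_F: "(F has_derivative F' y) (at y within \<phi> ` S)"
      by (simp add: F_def F'_def comp_assoc)
    have "\<not> surj (F' y)"
    proof
      assume "surj (F' y)"
      moreover have "f' (\<psi> y) = \<psi> \<circ> F' y \<circ> \<phi>"
        by (auto simp: F'_def inv)
      moreover have "surj \<psi>" "surj \<phi>"
        using inv by (metis surjI)+
      ultimately have "surj (f' (\<psi> y))"
        by (metis comp_surj)
      then show False
        using crit[OF y] by simp
    qed
    moreover have "(*v) (matrix (F' y)) = F' y"
      using has_derivative_linear[OF der_F] by (simp add: fun_eq_iff)
    ultimately have "rank (matrix (F' y)) \<noteq> CARD('a basis_index)"
      by (simp add: full_rank_surjective)
    then show "rank (matrix (F' y)) < CARD('a basis_index)"
      using rank_bound[of "matrix (F' y)"] by simp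
  qed simp
  \<comment> \<open>Back to the original space: \<open>\<psi>\<close> is linear, hence
    differentiable, and the dimensions agree, so it maps null sets to null sets.\<close>
  then have "negligible (\<psi> ` F ` \<phi> ` S)"
    by (rule negligible_differentiable_image_negligible[rotated])
      (auto simp: CARD_basis_index intro: linear_imp_differentiable_on lin)
  then show ?thesis
    by (simp add: F_def image_image inv)
qed

text \<open>If \<open>h\<close> had no zero, rescaling \<open>- h x\<close> to length
  \<open>r\<close> would give a continuous map of the ball into its boundary sphere. A Brouwer fixed
  point would lie on the sphere and be a negative multiple of \<open>h x\<close>, contradicting the
  outward condition there.\<close>

lemma exists_zero_if_outward_on_sphere:
  fixes h :: "'a::euclidean_space \<Rightarrow> 'a"
  assumes cont: "continuous_on (cball 0 r) h" and "r > 0"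
    and outward: "\<And>x. norm x = r \<Longrightarrow> h x \<bullet> x > 0"
  shows "\<exists>x\<in>cball 0 r. h x = 0"
proof (rule ccontr)
  assume "\<not> ?thesis"
  then have nz: "h x \<noteq> 0" if "x \<in> cball 0 r" for x
    using that by blast
  define F where "F x = (- r / norm (h x)) *\<^sub>R h x" for x
  have norm_F: "norm (F x) = r" if "x \<in> cball 0 r" for x
    using nz[OF that] \<open>r > 0\<close> by (simp add: F_def)
  have "continuous_on (cball 0 r) F"
    unfolding F_def using nz by (intro continuous_intros cont) auto
  moreover have "F \<in> cball 0 r \<rightarrow> cball 0 r"
    using norm_F by auto
  ultimately obtain x where x: "x \<in> cball 0 r" "F x = x"
    using brouwer[OF compact_cball convex_cball] \<open>r > 0\<close>
    by (metis cball_eq_empty not_less_iff_gr_or_eq)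
  then have "norm x = r"
    using norm_F by metis
  have "h x \<bullet> F x = - r * norm (h x)"
    using nz[OF x(1)] by (simp add: F_def dot_square_norm power2_eq_square)
  also have "\<dots> \<le> 0"
    using \<open>r > 0\<close> by simp
  finally show False
    using outward[OF \<open>norm x = r\<close>] x(2) by simp
qed

text \<open>For each target \<open>y\<close>, the field \<open>g x - y\<close> points outward on a
  large enough sphere, because the quadratic lower bound beats the linear term
  \<open>y \<bullet> x\<close>. A zero inside is a preimage of \<open>y\<close>.\<close>

lemma coercive_imp_surj:
  fixes g :: "'a::euclidean_space \<Rightarrow> 'a"
  assumes cont: "continuous_on UNIV g" and "m > 0" "c \<ge> 0"
    and coercive: "\<And>x. norm x \<ge> R \<Longrightarrow> g x \<bullet> x \<ge> m * (norm x)\<^sup>2 - c"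
  shows "surj g"
proof -
  have "\<exists>x. g x = y" for y
  proof -
    \<comment> \<open>\<open>R\<close> makes coercivity available on the sphere, \<open>1\<close>
      allows \<open>c\<close> to be bounded by \<open>c * r\<close>, and the last term gives
      \<open>m * r > c + norm y\<close>.\<close>
    define r where "r = max R (max 1 ((c + norm y) / m + 1))"
    have "r \<ge> R" "r \<ge> 1" and "r \<ge> (c + norm y) / m + 1"
      by (auto simp: r_def)
    then have r: "m * r > c + norm y"
      using \<open>m > 0\<close> by (simp add: field_simps)
    have "(g x - y) \<bullet> x > 0" if "norm x = r" for x
    proof -
      have "0 < r * (m * r - (c + norm y))"
        using r \<open>r \<ge> 1\<close> by simp
      also have "\<dots> \<le> m * r\<^sup>2 - c - norm y * r"
        using mult_left_mono[OF \<open>r \<ge> 1\<close> \<open>c \<ge> 0\<close>] by (simp add: algebra_simps power2_eq_square)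
      also have "\<dots> \<le> g x \<bullet> x - y \<bullet> x"
        using coercive[of x] norm_cauchy_schwarz[of y x] that \<open>r \<ge> R\<close> by simp
      finally show ?thesis
        by (simp add: inner_diff_left)
    qed
    moreover have "continuous_on (cball 0 r) (\<lambda>x. g x - y)"
      by (intro continuous_intros continuous_on_subset[OF cont]) auto
    ultimately show ?thesis
      using exists_zero_if_outward_on_sphere[of r "\<lambda>x. g x - y"] \<open>r \<ge> 1\<close> by auto
  qed
  then show ?thesis
    by (metis surjI)
qed

lemma det_Diag: "det (Diag v) = (\<Prod>i\<in>UNIV. v $ i)"
  by (subst det_diagonal) (auto simp: Diag_def)

text \<open>The determinant of \<open>A_mat f x\<close> is the product of the coordinates of
  \<open>grad f x\<close> times the determinant of the Hessian. Where it vanishes,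
  \<open>grad f x\<close> is thus a critical value of \<open>grad f\<close> or lies on one of
  finitely many coordinate hyperplanes.\<close>

lemma negligible_image_grad_det_A_mat_eq_0:
  fixes f :: "real ^ 'm \<Rightarrow> real"
  assumes "grad f differentiable_on UNIV"
  shows "negligible (grad f ` D_dagger (A_mat f))"
proof -
  define S where "S = {x. det (hessian f x) = 0}"
  have "negligible (grad f ` S)"
  proof (rule negligible_critical_values)
    fix x assume "x \<in> S"
    show der: "(grad f has_derivative frechet_derivative (grad f) (at x)) (at x within S)"
      using assms by (auto simp: differentiable_on_def frechet_derivative_works
          intro: has_derivative_at_withinI)
    have "\<not> surj ((*v) (hessian f x))"
      using \<open>x \<in> S\<close> by (simp add: S_def det_eq_0_rank flip: full_rank_surjective)
    moreover have "(*v) (hessian f x) = frechet_derivative (grad f) (at x)"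
      using has_derivative_linear[OF der] by (simp add: fun_eq_iff hessian_def)
    ultimately show "\<not> surj (frechet_derivative (grad f) (at x))"
      by simp
  qed
  moreover have "negligible {y :: real ^ 'm. y $ i = 0}" for i
    using negligible_hyperplane[of "axis i 1 :: real ^ 'm" 0] by (simp add: inner_axis')
  then have "negligible (\<Union>i. {y :: real ^ 'm. y $ i = 0})"
    by (intro negligible_Union) auto
  ultimately have "negligible (grad f ` S \<union> (\<Union>i. {y. y $ i = 0}))"
    by simp
  moreover have "grad f ` D_dagger (A_mat f) \<subseteq> grad f ` S \<union> (\<Union>i. {y. y $ i = 0})"
    by (auto simp: D_dagger_def A_mat_def det_mul det_Diag S_def)
  ultimately show ?thesis
    by (rule negligible_subset)
qed

theorem lemma5p1:
  fixes f :: "real ^ 'm \<Rightarrow> real"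
  assumes "C2 f"
    and "\<exists>L_f::real. \<forall>x y. norm (grad f x - grad f y) \<le> L_f * norm (x - y)"
    and "\<exists>(m_f::real) (c::real) (R::real). m_f > 0 \<and> c \<ge> 0 \<and> R \<ge> 0 \<and>
      (\<forall>x. norm x \<ge> R \<longrightarrow> grad f x \<bullet> x \<ge> m_f * (norm x)\<^sup>2 - c)"
  shows "D_dagger (A_mat f) \<noteq> UNIV"
proof
  assume "D_dagger (A_mat f) = UNIV"
  have diff: "grad f differentiable_on UNIV"
    using \<open>C2 f\<close> by (simp add: C2_def)
  have "surj (grad f)"
    using assms(3) coercive_imp_surj[OF differentiable_imp_continuous_on[OF diff]] by metis
  \<comment> \<open>The image of the gradient would be both null and the whole space.\<close>
  with negligible_image_grad_det_A_mat_eq_0[OF diff] \<open>D_dagger (A_mat f) = UNIV\<close>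
  show False
    by simp
qed

end
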